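(* If $\mathcal{U}\subseteq\mathcal{B}(H)$ is a hyperreflexive masa-bimodule and $\Phi\in\mathfrak{H}$, then the algebraic sum $\mathcal{U}+\operatorname{Ran}\Phi$ is hyperreflexive and $k(\mathcal{U}+\operatorname{Ran}\Phi)\leq k(\mathcal{U})\,\lambda(\Phi)$.
   Context: $H$ is a separable Hilbert space, $\mathcal{B}(H)$ is the space of bounded linear operators on $H$ with the operator norm, and $\mathcal{D}\subseteq\mathcal{B}(H)$ is a fixed maximal abelian selfadjoint algebra (masa). A masa-bimodule ($\mathcal{D}$-bimodule) is a weak* closed subspace $\mathcal{X}\subseteq\mathcal{B}(H)$ with $\mathcal{D}\mathcal{X}\mathcal{D}\subseteq\mathcal{X}$. For a subspace $\mathcal{X}\subseteq\mathcal{B}(H)$ and $T\in\mathcal{B}(H)$, put $d(T,\mathcal{X})=\inf_{X\in\mathcal{X}}\|T-X\|$ and $\alpha(T,\mathcal{X})=\sup\{\inf_{X\in\mathcal{X}}\|T\xi-X\xi\| : \xi\in H,\ \|\xi\|=1\}$. A weak* closed subspace $\mathcal{X}$ is hyperreflexive if there is $k>0$ with $d(T,\mathcal{X})\leq k\,\alpha(T,\mathcal{X})$ for all $T\in\mathcal{B}(H)$; the least (infimal) such $k$ is denoted $k(\mathcal{X})$. A Schur idempotent is a weak* continuous $\mathcal{D}$-bimodule (linear) map $\Phi$ on $\mathcal{B}(H)$ with $\Phi\circ\Phi=\Phi$. Put $\Phi^\perp=\mathrm{id}-\Phi$ and let $\operatorname{Ran}\Phi$ be the range of $\Phi$. $\mathfrak{H}$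 is the set of Schur idempotents $\Phi$ for which there is $\lambda>0$ with $\|\Phi^\perp(T)\|\leq\lambda\,\alpha(T,\operatorname{Ran}\Phi)$ for all $T\in\mathcal{B}(H)$; the least (infimal) such $\lambda$ is denoted $\lambda(\Phi)$. *)

theory Defs
  imports "HOL-Analysis.Analysis"
begin

section \<open>Complex Hilbert spaces\<close>

class complex_vector = real_vector +
  fixes scaleC :: "complex \<Rightarrow> 'a \<Rightarrow> 'a" (infixr "*\<^sub>C" 75)
  assumes scaleC_add_right: "c *\<^sub>C (x + y) = c *\<^sub>C x + c *\<^sub>C y"
    and scaleC_add_left: "(c + d) *\<^sub>C x = c *\<^sub>C x + d *\<^sub>C x"
    and scaleC_scaleC: "c *\<^sub>C d *\<^sub>C x = (c * d) *\<^sub>C x"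
    and scaleC_one: "1 *\<^sub>C x = x"
    and scaleR_scaleC: "scaleR r x = complex_of_real r *\<^sub>C x"

lemma vector_space_scaleC: "vector_space (scaleC :: complex \<Rightarrow> 'a \<Rightarrow> 'a::complex_vector)"
  by unfold_locales (simp_all add: scaleC_add_right scaleC_add_left scaleC_scaleC scaleC_one)

abbreviation csubspace :: "'a::complex_vector set \<Rightarrow> bool"
  where "csubspace \<equiv> module.subspace scaleC"

abbreviation clinear :: "('a::complex_vector \<Rightarrow> 'b::complex_vector) \<Rightarrow> bool"
  where "clinear \<equiv> Vector_Spaces.linear scaleC scaleC"

text \<open>The inner product is linear in the first argument.  The real inner product inherited from
  the library is its real part, so the norm of the library is the Hilbert space norm:
  \<open>cinner x x = (norm x)\<^sup>2\<close>.\<close>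

class complex_hilbert = complex_vector + real_inner + complete_space +
  fixes cinner :: "'a \<Rightarrow> 'a \<Rightarrow> complex"
  assumes cinner_commute: "cinner x y = cnj (cinner y x)"
    and cinner_add_left: "cinner (x + y) z = cinner x z + cinner y z"
    and cinner_scaleC_left: "cinner (c *\<^sub>C x) y = c * cinner x y"
    and inner_eq_Re_cinner: "inner x y = Re (cinner x y)"

lemma cinner_self: "cinner x x = complex_of_real ((norm x)\<^sup>2)"
proof -
  have "Im (cinner x x) = 0"
    using arg_cong[OF cinner_commute[of x x], of Im] by simp
  then show ?thesis
    by (simp add: complex_eq_iff power2_norm_eq_inner inner_eq_Re_cinner)
qed

lemma norm_scaleC: "norm (c *\<^sub>C x) = cmod c * norm (x::'a::complex_hilbert)"
proof -
  have "cinner (c *\<^sub>C x) (c *\<^sub>C x) = c * cnj c * cinner x x"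
    by (metis cinner_commute cinner_scaleC_left complex_cnj_mult mult.assoc)
  then have "complex_of_real ((norm (c *\<^sub>C x))\<^sup>2) = complex_of_real ((cmod c * norm x)\<^sup>2)"
    by (simp add: cinner_self complex_norm_square[symmetric] power_mult_distrib)
  then have "(norm (c *\<^sub>C x))\<^sup>2 = (cmod c * norm x)\<^sup>2"
    by (simp only: of_real_eq_iff)
  then show ?thesis
    by (simp add: power2_eq_iff_nonneg)
qed

lemma bounded_linear_scaleC: "bounded_linear (\<lambda>x::'a::complex_hilbert. c *\<^sub>C x)"
proof (rule bounded_linear_intro[where K = "cmod c"])
  fix x y :: 'a and r :: real
  show "c *\<^sub>C (x + y) = c *\<^sub>C x + c *\<^sub>C y" by (rule scaleC_add_right)
  show "c *\<^sub>C scaleR r x = scaleR r (c *\<^sub>C x)"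
    by (simp add: scaleR_scaleC scaleC_scaleC mult.commute)
  show "norm (c *\<^sub>C x) \<le> norm x * cmod c" by (simp add: norm_scaleC mult.commute)
qed

lemma scaleC_minus_right: "c *\<^sub>C (x - y) = c *\<^sub>C x - c *\<^sub>C (y::'a::complex_vector)"
  by (metis add_diff_cancel diff_add_cancel scaleC_add_right)

lemma scaleC_zero_right: "c *\<^sub>C (0::'a::complex_vector) = 0"
  by (metis diff_self scaleC_minus_right)

lemma scaleC_uminus_right: "c *\<^sub>C (- x) = - (c *\<^sub>C (x::'a::complex_vector))"
  by (metis diff_0 scaleC_minus_right scaleC_zero_right)

section \<open>The algebra of bounded operators\<close>

text \<open>Operators carry the operator norm \<open>onorm\<close>; the product is composition.\<close>

typedef (overloaded) 'a bop =
  "{f :: 'a::complex_hilbert \<Rightarrow> 'a. bounded_linear f \<and> (\<forall>c x. f (c *\<^sub>C x) = c *\<^sub>C f x)}"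
  morphisms bop_apply Bop
  by (rule exI[of _ "\<lambda>x. x"]) (simp add: bounded_linear_ident)

setup_lifting type_definition_bop

lemma bop_eqI: "(\<And>x. bop_apply S x = bop_apply T x) \<Longrightarrow> S = T"
  by (simp add: bop_apply_inject[symmetric] fun_eq_iff)

instantiation bop :: (complex_hilbert) real_normed_vector
begin

lift_definition norm_bop :: "'a bop \<Rightarrow> real" is onorm .

lift_definition minus_bop :: "'a bop \<Rightarrow> 'a bop \<Rightarrow> 'a bop" is "\<lambda>f g x. f x - g x"
  by (auto intro: bounded_linear_sub simp: scaleC_minus_right)

lift_definition uminus_bop :: "'a bop \<Rightarrow> 'a bop" is "\<lambda>f x. - f x"
  by (auto intro: bounded_linear_minus simp: scaleC_uminus_right)

lift_definition zero_bop :: "'a bop" is "\<lambda>x. 0"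
  by (simp add: bounded_linear_zero scaleC_zero_right)

lift_definition plus_bop :: "'a bop \<Rightarrow> 'a bop \<Rightarrow> 'a bop" is "\<lambda>f g x. f x + g x"
  by (auto intro: bounded_linear_add simp: scaleC_add_right)

lift_definition scaleR_bop :: "real \<Rightarrow> 'a bop \<Rightarrow> 'a bop" is "\<lambda>r f x. scaleR r (f x)"
  by (auto intro: bounded_linear_compose[OF bounded_linear_scaleR_right])
    (simp add: scaleR_scaleC scaleC_scaleC mult.commute)

definition dist_bop :: "'a bop \<Rightarrow> 'a bop \<Rightarrow> real"
  where "dist_bop S T = norm (S - T)"

definition [code del]:
  "(uniformity :: ('a bop \<times> 'a bop) filter) = (INF e\<in>{0 <..}. principal {(S, T). dist S T < e})"

definition open_bop :: "'a bop set \<Rightarrow> bool"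
  where [code del]: "open_bop S = (\<forall>x\<in>S. \<forall>\<^sub>F (x', y) in uniformity. x' = x \<longrightarrow> y \<in> S)"

definition sgn_bop :: "'a bop \<Rightarrow> 'a bop"
  where "sgn_bop T = scaleR (inverse (norm T)) T"

instance
  apply standard
  unfolding dist_bop_def open_bop_def sgn_bop_def uniformity_bop_def
  apply (rule refl | (transfer, force simp: onorm_triangle onorm_scaleR onorm_eq_0 algebra_simps))+
  done

end

instantiation bop :: (complex_hilbert) complex_vector
begin

lift_definition scaleC_bop :: "complex \<Rightarrow> 'a bop \<Rightarrow> 'a bop" is "\<lambda>c f x. c *\<^sub>C f x"
  by (auto intro: bounded_linear_compose[OF bounded_linear_scaleC]
      simp: scaleC_scaleC mult.commute)

instance
  by standard
    (transfer, simp add: scaleC_add_right scaleC_add_left scaleC_scaleC scaleC_one scaleR_scaleC)+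

end

instantiation bop :: (complex_hilbert) "{real_normed_algebra, monoid_mult}"
begin

lift_definition one_bop :: "'a bop" is "\<lambda>x. x"
  by (simp add: bounded_linear_ident)

lift_definition times_bop :: "'a bop \<Rightarrow> 'a bop \<Rightarrow> 'a bop" is "\<lambda>f g x. f (g x)"
  by (auto intro: bounded_linear_compose)

instance
proof
  fix S T R :: "'a bop" and r :: real
  show "S * T * R = S * (T * R)" by transfer simp
  show "1 * S = S" "S * 1 = S" by (transfer; simp)+
  show "(S + T) * R = S * R + T * R" by transfer simp
  show "S * (T + R) = S * T + S * R"
    by transfer (auto simp: linear_simps(1))
  show "scaleR r S * T = scaleR r (S * T)" by transfer simp
  show "S * scaleR r T = scaleR r (S * T)"
    by transfer (auto simp: linear_simps(5))
  show "norm (S * T) \<le> norm S * norm T"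
    by transfer (use onorm_compose in \<open>auto simp: o_def\<close>)
qed

end

definition adj :: "'a::complex_hilbert bop \<Rightarrow> 'a bop"
  where "adj T = (THE S. \<forall>x y. cinner (bop_apply T x) y = cinner x (bop_apply S y))"

text \<open>The weak* topology is the one induced by the predual of trace class operators.  Every weak*
  continuous functional, that is \<open>T \<mapsto> tr (T A)\<close> with \<open>A\<close> of trace class, has the form
  \<open>T \<mapsto> (\<Sum>n. \<langle>T \<xi>\<^sub>n, \<eta>\<^sub>n\<rangle>)\<close> with square-summable sequences \<open>\<xi>\<close>, \<open>\<eta>\<close>, and conversely.\<close>

definition normal_functionals :: "('a::complex_hilbert bop \<Rightarrow> complex) set"
  where "normal_functionals =
    {\<lambda>T. \<Sum>n. cinner (bop_apply T (\<xi> n)) (\<eta> n) | \<xi> \<eta> :: nat \<Rightarrow> 'a.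
      summable (\<lambda>n. (norm (\<xi> n))\<^sup>2) \<and> summable (\<lambda>n. (norm (\<eta> n))\<^sup>2)}"

definition weak_star :: "'a::complex_hilbert bop topology"
  where "weak_star = topology_generated_by {f -` V | f V. f \<in> normal_functionals \<and> open V}"

section \<open>Masas, bimodules and Schur idempotents\<close>

definition abelian_selfadjoint_algebra :: "'a::complex_hilbert bop set \<Rightarrow> bool"
  where "abelian_selfadjoint_algebra \<D> \<longleftrightarrow>
    csubspace \<D> \<and> (\<forall>A\<in>\<D>. \<forall>B\<in>\<D>. A * B \<in> \<D>) \<and> (\<forall>A\<in>\<D>. adj A \<in> \<D>) \<and>
    (\<forall>A\<in>\<D>. \<forall>B\<in>\<D>. A * B = B * A)"

definition masa :: "'a::complex_hilbert bop set \<Rightarrow> bool"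
  where "masa \<D> \<longleftrightarrow> abelian_selfadjoint_algebra \<D> \<and>
    (\<forall>\<E>. abelian_selfadjoint_algebra \<E> \<and> \<D> \<subseteq> \<E> \<longrightarrow> \<E> = \<D>)"

definition masa_bimodule :: "'a::complex_hilbert bop set \<Rightarrow> 'a bop set \<Rightarrow> bool"
  where "masa_bimodule \<D> \<X> \<longleftrightarrow> csubspace \<X> \<and> closedin weak_star \<X> \<and>
    (\<forall>A\<in>\<D>. \<forall>X\<in>\<X>. \<forall>B\<in>\<D>. A * X * B \<in> \<X>)"

definition schur_idempotent :: "'a::complex_hilbert bop set \<Rightarrow> ('a bop \<Rightarrow> 'a bop) \<Rightarrow> bool"
  where "schur_idempotent \<D> \<Phi> \<longleftrightarrow> clinear \<Phi> \<and> continuous_map weak_star weak_star \<Phi> \<and>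
    (\<forall>A\<in>\<D>. \<forall>T. \<forall>B\<in>\<D>. \<Phi> (A * T * B) = A * \<Phi> T * B) \<and> \<Phi> \<circ> \<Phi> = \<Phi>"

section \<open>Hyperreflexivity\<close>

text \<open>The distance \<open>d(T, \<X>)\<close> is \<open>infdist T \<X>\<close>.  All infima in the following supremum are
  nonnegative, so inserting \<open>0\<close> changes nothing unless the Hilbert space is zero, where it gives
  the supremum over the empty unit sphere the value \<open>0\<close>.\<close>

definition alpha :: "'a::complex_hilbert bop \<Rightarrow> 'a bop set \<Rightarrow> real"
  where "alpha T \<X> =
    Sup (insert 0 {INF X\<in>\<X>. norm (bop_apply T \<xi> - bop_apply X \<xi>) | \<xi>. norm \<xi> = 1})"

definition hyperreflexive :: "'a::complex_hilbert bop set \<Rightarrow> bool"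
  where "hyperreflexive \<X> \<longleftrightarrow> csubspace \<X> \<and> closedin weak_star \<X> \<and>
    (\<exists>k>0. \<forall>T. infdist T \<X> \<le> k * alpha T \<X>)"

definition hyperreflexivity_constant :: "'a::complex_hilbert bop set \<Rightarrow> real"
  where "hyperreflexivity_constant \<X> = Inf {k. k > 0 \<and> (\<forall>T. infdist T \<X> \<le> k * alpha T \<X>)}"

definition schur_frakH :: "'a::complex_hilbert bop set \<Rightarrow> ('a bop \<Rightarrow> 'a bop) set"
  where "schur_frakH \<D> = {\<Phi>. schur_idempotent \<D> \<Phi> \<and>
    (\<exists>l>0. \<forall>T. norm (T - \<Phi> T) \<le> l * alpha T (range \<Phi>))}"

definition schur_constant :: "('a::complex_hilbert bop \<Rightarrow> 'a bop) \<Rightarrow> real"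
  where "schur_constant \<Phi> = Inf {l. l > 0 \<and> (\<forall>T. norm (T - \<Phi> T) \<le> l * alpha T (range \<Phi>))}"

end

theory Submission
  imports Defs
begin

text \<open>Since \<open>T - (T - \<Phi> T)\<close> lies in the range of \<open>\<Phi>\<close>, the distance of \<open>T\<close> to \<open>\<U> + Ran \<Phi>\<close> is at most
  \<open>k * alpha (T - \<Phi> T) \<U>\<close>.  Compressing by projections of the masa, which commute with \<open>\<Phi>\<close>, shows
  \<open>alpha (T - \<Phi> T) \<U> \<le> \<lambda> * alpha T (\<U> + Ran \<Phi>)\<close>.  For \<open>T \<in> \<U>\<close> the right-hand side vanishes, so that
  \<open>T - \<Phi> T \<in> \<U>\<close> because \<open>\<U>\<close> is hyperreflexive.  Hence \<open>\<U> + Ran \<Phi>\<close> is the preimage of \<open>\<U>\<close> under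
  the weak* continuous map \<open>T \<mapsto> T - \<Phi> T\<close>, and it is weak* closed.\<close>

section \<open>Complex subspaces as real subspaces\<close>

lemma csubspace_iff:
  "csubspace (S::'a::complex_vector set) \<longleftrightarrow>
    0 \<in> S \<and> (\<forall>x\<in>S. \<forall>y\<in>S. x + y \<in> S) \<and> (\<forall>c. \<forall>x\<in>S. c *\<^sub>C x \<in> S)"
  by (rule module.subspace_def) (simp add: module_iff_vector_space vector_space_scaleC)

lemma csubspace_imp_subspace: "csubspace S \<Longrightarrow> subspace S"
  by (simp add: csubspace_iff subspace_def scaleR_scaleC)

lemma csubspace_diff: "csubspace S \<Longrightarrow> x \<in> S \<Longrightarrow> y \<in> S \<Longrightarrow> x - y \<in> S"
  by (simp add: csubspace_imp_subspace subspace_diff)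

lemma scaleC_zero_left: "0 *\<^sub>C (x::'a::complex_vector) = 0"
  by (metis of_real_0 scaleR_scaleC scaleR_zero_left)

section \<open>Riesz representation, adjoints and projections\<close>

text \<open>The representing vector minimises \<open>(norm v)\<^sup>2 - 2 * f v\<close>; the parallelogram law makes a
  minimising sequence Cauchy.\<close>

lemma riesz_closed_subspace:
  fixes V :: "'a::{real_inner,complete_space} set"
  assumes f: "bounded_linear f" and V: "subspace V" "closed V"
  shows "\<exists>v\<in>V. \<forall>w\<in>V. f w = inner v w"
proof -
  interpret f: bounded_linear f by fact
  define J where "J = (\<lambda>v. (norm v)\<^sup>2 - 2 * f v)"
  obtain K where K: "\<And>x. norm (f x) \<le> norm x * K" using f.bounded by blast
  \<comment> \<open>Completing the square: \<open>J v\<close> is at least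
    \<open>(norm v - K)\<^sup>2 - K\<^sup>2\<close>.\<close>
  have lower: "- K\<^sup>2 \<le> J v" for v
  proof -
    have "f v \<le> norm v * K" using K[of v] by simp
    moreover have "0 \<le> (norm v - K)\<^sup>2" by simp
    ultimately show ?thesis unfolding J_def power2_eq_square by (simp add: algebra_simps)
  qed
  then have bdd: "bdd_below (J ` V)" by (auto simp: bdd_below_def)
  have "V \<noteq> {}" using V(1) subspace_0 by blast
  define m where "m = Inf (J ` V)"
  have m: "m \<le> J v" if "v \<in> V" for v
    unfolding m_def using bdd that by (simp add: cINF_lower)
  have "\<exists>v\<in>V. J v < m + 1 / Suc n" for n
    using cInf_lessD[of "J ` V" "m + 1 / Suc n"] \<open>V \<noteq> {}\<close> unfolding m_def by auto
  then obtain v where v: "\<And>n. v n \<in> V" and Jv: "\<And>n. J (v n) < m + 1 / Suc n"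
    by metis
  have para: "(norm (x - y))\<^sup>2 / 2 = J x + J y - 2 * J ((1/2) *\<^sub>R (x + y))" for x y
    unfolding J_def
    by (simp add: f.scaleR f.add power2_norm_eq_inner inner_simps inner_commute power_divide field_simps)
  \<comment> \<open>Midpoints of the sequence stay in \<open>V\<close>, so \<open>m\<close> bounds
    \<open>J\<close> from below there too and the parallelogram identity controls the
    distance.\<close>
  have close: "(norm (v i - v j))\<^sup>2 \<le> 2 * (1 / Suc i + 1 / Suc j)" for i j
  proof -
    have "m \<le> J ((1/2) *\<^sub>R (v i + v j))"
      by (intro m subspace_scale subspace_add V v)
    with para[of "v i" "v j"] Jv[of i] Jv[of j] show ?thesis by argo
  qed
  have "Cauchy v"
  proof (rule metric_CauchyI)
    fix e :: real assume "0 < e"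
    then obtain N where N: "1 / Suc N < e\<^sup>2 / 4"
      using reals_Archimedean[of "e\<^sup>2 / 4"] by (auto simp: inverse_eq_divide)
    have "dist (v i) (v j) < e" if "i \<ge> N" "j \<ge> N" for i j
    proof -
      have "1 / Suc i \<le> 1 / Suc N" "1 / Suc j \<le> 1 / Suc N"
        using that by (simp_all add: frac_le)
      then have "(norm (v i - v j))\<^sup>2 < e\<^sup>2" using close[of i j] N by argo
      then show ?thesis using \<open>0 < e\<close> by (simp add: dist_norm power2_less_imp_less)
    qed
    then show "\<exists>M. \<forall>m\<ge>M. \<forall>n\<ge>M. dist (v m) (v n) < e" by blast
  qed
  then obtain l where l: "v \<longlonglongrightarrow> l" using Cauchy_convergent convergent_def by blast
  have "l \<in> V" using closed_sequentially[OF V(2)] v l by blast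
  have "(\<lambda>n. J (v n)) \<longlonglongrightarrow> J l" unfolding J_def by (intro tendsto_intros l f.tendsto)
  moreover have "(\<lambda>n. m + 1 / Suc n) \<longlonglongrightarrow> m + 0"
    using LIMSEQ_inverse_real_of_nat by (intro tendsto_intros) (simp add: inverse_eq_divide)
  ultimately have "J l \<le> m + 0"
    by (rule LIMSEQ_le) (use Jv less_imp_le in blast)
  then have Jl: "J l \<le> m" by simp
  have "f w = inner l w" if "w \<in> V" for w
  proof (rule ccontr)
    assume ne: "f w \<noteq> inner l w"
    define a where "a = inner l w - f w"
    have w: "(norm w)\<^sup>2 > 0" using ne f.zero by force
    \<comment> \<open>This \<open>t\<close> minimises
      \<open>2 * t * a + t\<^sup>2 * (norm w)\<^sup>2\<close>, with value
      \<open>- a\<^sup>2 / (norm w)\<^sup>2\<close>; minimality of \<open>l\<close> then forces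
      \<open>a = 0\<close>.\<close>
    define t where "t = - a / (norm w)\<^sup>2"
    have "J l \<le> J (l + t *\<^sub>R w)"
      using Jl m[of "l + t *\<^sub>R w"] V(1) \<open>l \<in> V\<close> that
      by (meson order_trans subspace_add subspace_scale)
    also have "J (l + t *\<^sub>R w) = J l + 2 * t * a + t\<^sup>2 * (norm w)\<^sup>2"
      unfolding J_def a_def power2_norm_eq_inner
      by (simp add: f.scaleR f.add inner_simps inner_commute power2_eq_square algebra_simps)
    also have "\<dots> = J l - a\<^sup>2 / (norm w)\<^sup>2"
      using w unfolding t_def by (simp add: power2_eq_square field_simps)
    finally have "a\<^sup>2 \<le> 0" using w by (simp add: field_simps)
    then show False using ne a_def by simp
  qed
  with \<open>l \<in> V\<close> show ?thesis by blast
qed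

section \<open>The complex inner product, bounded operators and adjoints\<close>

lemma cinner_add_right: "cinner x (y + z) = cinner x y + cinner x (z::'a::complex_hilbert)"
  by (metis cinner_add_left cinner_commute complex_cnj_add)

lemma cinner_scaleC_right: "cinner x (c *\<^sub>C y) = cnj c * cinner x (y::'a::complex_hilbert)"
  by (metis cinner_commute cinner_scaleC_left complex_cnj_mult)

lemma Im_cinner: "Im (cinner x y) = - inner (\<i> *\<^sub>C x) (y::'a::complex_hilbert)"
  by (simp add: inner_eq_Re_cinner cinner_scaleC_left)

text \<open>The imaginary part of \<open>cinner\<close> is a real inner product with the first
  argument multiplied by the imaginary unit, and \<open>f\<close> commutes with that
  multiplication.\<close>

lemma cinner_eq_if_inner_eq:
  fixes f :: "'a::complex_hilbert \<Rightarrow> 'a"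
  assumes "\<And>x. inner (f x) y = inner x z" and "\<And>c x. f (c *\<^sub>C x) = c *\<^sub>C f x"
  shows "cinner (f x) y = cinner x z"
  by (simp add: complex_eq_iff Im_cinner assms(1) flip: inner_eq_Re_cinner assms(2))

text \<open>A unimodular multiple of \<open>x\<close> makes the inner product real and nonnegative,
  which reduces the bound to the real Cauchy-Schwarz inequality.\<close>

lemma cmod_cinner_le: "cmod (cinner x y) \<le> norm x * norm (y::'a::complex_hilbert)"
proof (cases "cinner x y = 0")
  case False
  define c where "c = cnj (cinner x y) / cmod (cinner x y)"
  have "cinner (c *\<^sub>C x) y = cmod (cinner x y)"
    using False unfolding c_def
    by (simp add: cinner_scaleC_left complex_norm_square[symmetric] mult.commute power2_eq_square)
  then have "cmod (cinner x y) = inner (c *\<^sub>C x) y"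
    by (simp add: inner_eq_Re_cinner)
  also have "\<dots> \<le> norm (c *\<^sub>C x) * norm y" by (rule norm_cauchy_schwarz)
  also have "norm (c *\<^sub>C x) = norm x" using False by (simp add: norm_scaleC c_def norm_divide)
  finally show ?thesis .
qed simp

lemma bounded_linear_bop_apply: "bounded_linear (bop_apply T)"
  using bop_apply[of T] by simp

lemma bop_apply_scaleC: "bop_apply T (c *\<^sub>C x) = c *\<^sub>C bop_apply T x"
  using bop_apply[of T] by simp

lemma norm_bop_apply: "norm (bop_apply T x) \<le> norm T * norm x"
  by (simp add: norm_bop.rep_eq onorm bounded_linear_bop_apply)

lemmas bop_apply_simps = plus_bop.rep_eq minus_bop.rep_eq zero_bop.rep_eq scaleC_bop.rep_eq
  times_bop.rep_eq one_bop.rep_eq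

lemma scaleC_bop_mult: "(c *\<^sub>C S) * T = c *\<^sub>C (S * (T::'a::complex_hilbert bop))"
  "S * (c *\<^sub>C T) = c *\<^sub>C (S * T)"
  by (rule bop_eqI, simp add: bop_apply_simps bop_apply_scaleC)+

text \<open>Real Riesz representation on the whole space yields \<open>g y\<close> for each
  \<open>y\<close>; \<open>g\<close> is complex linear because inner products separate
  vectors.\<close>

lemma adjoint_exists:
  fixes T :: "'a::complex_hilbert bop"
  shows "\<exists>S. \<forall>x y. cinner (bop_apply T x) y = cinner x (bop_apply S y)"
proof -
  have "\<exists>z. \<forall>x. inner (bop_apply T x) y = inner x z" for y
    using riesz_closed_subspace[of "\<lambda>x. inner (bop_apply T x) y" UNIV]
      bounded_linear_compose[OF bounded_linear_inner_left bounded_linear_bop_apply]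
    by (auto simp: inner_commute)
  then obtain g where g: "\<And>x y. inner (bop_apply T x) y = inner x (g y)" by metis
  have cg: "cinner (bop_apply T x) y = cinner x (g y)" for x y
    by (rule cinner_eq_if_inner_eq) (simp_all add: g bop_apply_scaleC)
  have inj: "u = v" if "\<And>x. inner x u = inner x v" for u v :: 'a
    using that[of "u - v"] by (metis inner_diff_right inner_eq_zero_iff right_minus_eq)
  have cinj: "u = v" if "\<And>x. cinner x u = cinner x v" for u v :: 'a
    by (rule inj) (simp add: inner_eq_Re_cinner that)
  have gC: "g (c *\<^sub>C y) = c *\<^sub>C g y" for c y
    by (rule cinj) (simp add: cinner_scaleC_right flip: cg)
  have "bounded_linear g"
  proof (rule bounded_linear_intro[where K = "norm T"])
    show "g (x + y) = g x + g y" for x y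
      by (rule cinj) (simp add: cinner_add_right flip: cg)
    show "g (r *\<^sub>R x) = r *\<^sub>R g x" for r x by (simp add: scaleR_scaleC gC)
    show "norm (g y) \<le> norm y * norm T" for y
    proof (cases "g y = 0")
      case False
      have "norm (g y) * norm (g y) = inner (bop_apply T (g y)) y"
        by (simp add: g power2_norm_eq_inner flip: power2_eq_square)
      also have "\<dots> \<le> norm (bop_apply T (g y)) * norm y" by (rule norm_cauchy_schwarz)
      also have "\<dots> \<le> norm T * norm (g y) * norm y"
        by (simp add: mult_right_mono norm_bop_apply)
      finally show ?thesis using False by (simp add: mult.commute mult.left_commute)
    qed simp
  qed
  then have "bop_apply (Bop g) = g" by (simp add: Bop_inverse gC)
  then show ?thesis using cg by metis
qed

text \<open>Together with existence, this gives the definite description in \<open>adj\<close> its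
  meaning.\<close>

lemma adj_unique:
  fixes T :: "'a::complex_hilbert bop"
  assumes "\<And>x y. cinner (bop_apply T x) y = cinner x (bop_apply S y)"
  shows "adj T = S"
  unfolding adj_def
proof (rule the_equality)
  fix R assume R: "\<forall>x y. cinner (bop_apply T x) y = cinner x (bop_apply R y)"
  show "R = S"
  proof (rule bop_eqI)
    fix y
    have "inner x (bop_apply R y) = inner x (bop_apply S y)" for x
      using R assms by (metis inner_eq_Re_cinner)
    then show "bop_apply R y = bop_apply S y"
      by (metis inner_diff_right inner_eq_zero_iff right_minus_eq)
  qed
qed (use assms in blast)

lemma cinner_adj: "cinner (bop_apply T x) y = cinner x (bop_apply (adj T) y)"
  using adjoint_exists[of T] adj_unique[of T] by metis

section \<open>Orthogonal projections onto closed complex subspaces\<close>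

text \<open>The functional \<open>inner x\<close> restricted to \<open>M\<close> is represented by a
  vector of \<open>M\<close>, which is the projection of \<open>x\<close>.\<close>

lemma projection_exists:
  fixes M :: "'a::complex_hilbert set"
  assumes M: "csubspace M" "closed M"
  obtains P :: "'a bop" where "\<And>x. bop_apply P x \<in> M" and "\<And>x. x \<in> M \<Longrightarrow> bop_apply P x = x"
    and "\<And>x w. w \<in> M \<Longrightarrow> inner (x - bop_apply P x) w = 0"
proof -
  have sM: "subspace M" by (rule csubspace_imp_subspace) fact
  have "\<exists>p\<in>M. \<forall>w\<in>M. inner x w = inner p w" for x
    by (rule riesz_closed_subspace[OF bounded_linear_inner_right sM M(2)])
  then obtain p where p: "\<And>x. p x \<in> M" "\<And>x w. w \<in> M \<Longrightarrow> inner x w = inner (p x) w" by metis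
  have uniq: "p x = z" if "z \<in> M" "\<And>w. w \<in> M \<Longrightarrow> inner x w = inner z w" for x z
  proof -
    have "p x - z \<in> M" using p(1) that(1) sM subspace_diff by blast
    then have "inner (p x - z) (p x - z) = 0" using that p(2) by (metis inner_diff_left right_minus_eq)
    then show ?thesis by simp
  qed
  \<comment> \<open>Testing also against \<open>w\<close> times the imaginary unit, again a vector
    of \<open>M\<close>, recovers the imaginary part.\<close>
  have cp: "cinner x w = cinner (p x) w" if "w \<in> M" for x w
  proof -
    have "\<i> *\<^sub>C w \<in> M" using M(1) that by (simp add: csubspace_iff)
    then have "inner x (\<i> *\<^sub>C w) = inner (p x) (\<i> *\<^sub>C w)" by (rule p(2))
    with p(2)[OF that, of x] show ?thesis
      by (simp add: inner_eq_Re_cinner cinner_scaleC_right complex_eq_iff)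
  qed
  have pC: "p (c *\<^sub>C x) = c *\<^sub>C p x" for c x
    using M(1) p(1) by (intro uniq) (auto simp: csubspace_iff inner_eq_Re_cinner cinner_scaleC_left simp flip: cp)
  have "bounded_linear p"
  proof (rule bounded_linear_intro[where K = 1])
    show "p (x + y) = p x + p y" for x y
      by (rule uniq) (simp_all add: p sM subspace_add inner_add_left flip: p(2))
    show "p (r *\<^sub>R x) = r *\<^sub>R p x" for r x by (simp add: scaleR_scaleC pC)
    show "norm (p x) \<le> norm x * 1" for x
    proof (cases "p x = 0")
      case False
      have "norm (p x) * norm (p x) = inner x (p x)"
        by (metis p power2_norm_eq_inner power2_eq_square)
      also have "\<dots> \<le> norm x * norm (p x)" by (rule norm_cauchy_schwarz)
      finally show ?thesis using False by simp
    qed simp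
  qed
  then have "bop_apply (Bop p) = p" by (simp add: Bop_inverse pC)
  then show ?thesis
    by (intro that[of "Bop p"]) (use p(1) uniq in \<open>auto simp: inner_diff_left simp flip: p(2)\<close>)
qed

text \<open>Invariance under both \<open>A\<close> and \<open>adj A\<close> makes \<open>M\<close>
  reducing for \<open>A\<close>. Concretely, \<open>?u - ?v\<close> lies in \<open>M\<close> and
  turns out to be orthogonal to itself.\<close>

lemma projection_commutes:
  fixes M :: "'a::complex_hilbert set"
  assumes M: "csubspace M"
    and P: "\<And>x. bop_apply P x \<in> M" "\<And>x. x \<in> M \<Longrightarrow> bop_apply P x = x"
      "\<And>x w. w \<in> M \<Longrightarrow> inner (x - bop_apply P x) w = 0"
    and A: "\<And>x. x \<in> M \<Longrightarrow> bop_apply A x \<in> M" "\<And>x. x \<in> M \<Longrightarrow> bop_apply (adj A) x \<in> M"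
  shows "P * A = A * P"
proof (rule bop_eqI)
  fix x
  interpret A: bounded_linear "bop_apply A" by (rule bounded_linear_bop_apply)
  let ?u = "bop_apply P (bop_apply A x)" and ?v = "bop_apply A (bop_apply P x)"
  have m: "?u - ?v \<in> M" by (intro csubspace_diff M P A)
  have "inner (bop_apply A x - ?v) (?u - ?v) = inner (x - bop_apply P x) (bop_apply (adj A) (?u - ?v))"
    by (simp add: inner_eq_Re_cinner cinner_adj flip: A.diff)
  also have "\<dots> = 0" by (intro P A m)
  finally have "inner (bop_apply A x - ?v) (?u - ?v) = 0" .
  moreover have "inner (bop_apply A x - ?u) (?u - ?v) = 0" by (intro P m)
  ultimately have "inner (?u - ?v) (?u - ?v) = 0" by (simp add: inner_diff_left)
  then show "bop_apply (P * A) x = bop_apply (A * P) x" by (simp add: bop_apply_simps)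
qed

lemma projection_selfadjoint:
  fixes M :: "'a::complex_hilbert set"
  assumes P: "\<And>x. bop_apply P x \<in> M" "\<And>x w. w \<in> M \<Longrightarrow> inner (x - bop_apply P x) w = 0"
  shows "adj P = P"
proof (rule adj_unique, rule cinner_eq_if_inner_eq)
  fix x y
  have "inner (x - bop_apply P x) (bop_apply P y) = 0" "inner (y - bop_apply P y) (bop_apply P x) = 0"
    by (intro P)+
  then show "inner (bop_apply P x) y = inner x (bop_apply P y)"
    by (simp add: inner_diff_left) (simp add: inner_commute)
qed (rule bop_apply_scaleC)

text \<open>Pythagoras for \<open>x\<close> as the sum of its image under \<open>P\<close> and the
  remainder.\<close>

lemma norm_projection_compl_le:
  fixes P :: "'a::complex_hilbert bop"
  assumes "inner (x - bop_apply P x) (bop_apply P x) = 0"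
  shows "norm (bop_apply P x) \<le> norm x" "norm (bop_apply (1 - P) x) \<le> norm x"
proof -
  have "(norm x)\<^sup>2 = (norm (bop_apply P x))\<^sup>2 + (norm (x - bop_apply P x))\<^sup>2"
    using assms unfolding power2_norm_eq_inner by (simp add: inner_simps inner_commute)
  then show "norm (bop_apply P x) \<le> norm x" "norm (bop_apply (1 - P) x) \<le> norm x"
    by (simp_all add: bop_apply_simps power2_le_imp_le)
qed

section \<open>Closures of invariant subspaces and projections in the masa\<close>

lemma csubspace_closure:
  fixes S :: "'a::complex_hilbert set"
  assumes "csubspace S" shows "csubspace (closure S)"
  unfolding csubspace_iff
proof (intro conjI ballI allI)
  show "0 \<in> closure S" using assms closure_subset by (auto simp: csubspace_iff)
  show "x + y \<in> closure S" if "x \<in> closure S" "y \<in> closure S" for x y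
  proof -
    obtain u v where "\<And>n. u n \<in> S" "u \<longlonglongrightarrow> x" "\<And>n. v n \<in> S" "v \<longlonglongrightarrow> y"
      using \<open>x \<in> closure S\<close> \<open>y \<in> closure S\<close> unfolding closure_sequential by blast
    then show ?thesis
      using assms unfolding closure_sequential csubspace_iff
      by (intro exI[of _ "\<lambda>n. u n + v n"]) (auto intro: tendsto_add)
  qed
  show "c *\<^sub>C x \<in> closure S" if "x \<in> closure S" for c x
  proof -
    have "(\<lambda>x. c *\<^sub>C x) ` closure S \<subseteq> closure S"
      using assms closure_subset[of S]
      by (intro image_closure_subset bounded_linear.continuous_on[OF bounded_linear_scaleC])
        (auto simp: csubspace_iff)
    then show ?thesis using that by blast
  qed
qed

lemma bop_apply_closure:
  assumes "\<And>x. x \<in> S \<Longrightarrow> bop_apply A x \<in> closure R" and "x \<in> closure S"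
  shows "bop_apply A x \<in> closure R"
proof -
  have "bop_apply A ` closure S \<subseteq> closure R"
    using assms(1)
    by (intro image_closure_subset bounded_linear.continuous_on[OF bounded_linear_bop_apply]) auto
  then show ?thesis using assms(2) by blast
qed

text \<open>Adjoining \<open>P\<close> to \<open>\<D>\<close> gives an abelian selfadjoint algebra; the summand \<open>c *\<^sub>C P\<close> is there
  because \<open>\<D>\<close> is not assumed unital.\<close>

lemma masa_contains_commuting_projection:
  fixes \<D> :: "'a::complex_hilbert bop set"
  assumes D: "masa \<D>" and P: "P * P = P" "adj P = P" and comm: "\<And>A. A \<in> \<D> \<Longrightarrow> P * A = A * P"
  shows "P \<in> \<D>"
proof -
  define E where "E = {A + B * P + c *\<^sub>C P | A B c. A \<in> \<D> \<and> B \<in> \<D>}"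
  have D': "0 \<in> \<D>" "\<And>A B. A \<in> \<D> \<Longrightarrow> B \<in> \<D> \<Longrightarrow> A + B \<in> \<D>" "\<And>A c. A \<in> \<D> \<Longrightarrow> c *\<^sub>C A \<in> \<D>"
    "\<And>A B. A \<in> \<D> \<Longrightarrow> B \<in> \<D> \<Longrightarrow> A * B \<in> \<D>" "\<And>A. A \<in> \<D> \<Longrightarrow> adj A \<in> \<D>"
    "\<And>A B. A \<in> \<D> \<Longrightarrow> B \<in> \<D> \<Longrightarrow> A * B = B * A"
    using D unfolding masa_def abelian_selfadjoint_algebra_def csubspace_iff by blast+
  have EI: "A + B * P + c *\<^sub>C P \<in> E" if "A \<in> \<D>" "B \<in> \<D>" for A B c
    using that unfolding E_def by blast
  have EE: "\<exists>A B c. X = A + B * P + c *\<^sub>C P \<and> A \<in> \<D> \<and> B \<in> \<D>" if "X \<in> E" for X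
    using that unfolding E_def by blast
  have cP: "P * (A * X) = A * (P * X)" if "A \<in> \<D>" for A X
    by (metis comm that mult.assoc)
  have PP: "P * (P * X) = P * X" for X by (metis P(1) mult.assoc)
  \<comment> \<open>All factors \<open>P\<close> are moved to the right. Up to commuting elements of
    \<open>\<D>\<close>, the result is symmetric in primed and unprimed letters, so it yields both
    closure under products and commutativity.\<close>
  have prod: "(A + B * P + c *\<^sub>C P) * (A' + B' * P + c' *\<^sub>C P) =
      A * A' + (A * B' + c' *\<^sub>C A + B * A' + B * B' + c' *\<^sub>C B + c *\<^sub>C A' + c *\<^sub>C B') * P
        + (c * c') *\<^sub>C P"
    if "A \<in> \<D>" "B \<in> \<D>" "A' \<in> \<D>" "B' \<in> \<D>" for A B A' B' c c'
    using that
    by (simp add: distrib_left distrib_right mult.assoc scaleC_bop_mult scaleC_scaleC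
        comm cP P(1) PP scaleC_add_right add.assoc add.commute add.left_commute
        mult.commute[of c' c])
  have "abelian_selfadjoint_algebra E"
    unfolding abelian_selfadjoint_algebra_def csubspace_iff
  proof (intro conjI ballI allI)
    show "0 \<in> E" using EI[OF D'(1) D'(1), of 0] by (simp add: scaleC_zero_left)
    fix X c assume "X \<in> E"
    then obtain A B a where X: "X = A + B * P + a *\<^sub>C P" and AB: "A \<in> \<D>" "B \<in> \<D>"
      using EE by blast
    have "c *\<^sub>C X = c *\<^sub>C A + (c *\<^sub>C B) * P + (c * a) *\<^sub>C P"
      by (simp add: X scaleC_add_right scaleC_scaleC scaleC_bop_mult)
    then show "c *\<^sub>C X \<in> E" using EI D' AB by simp
    have "adj X = adj A + adj B * P + cnj a *\<^sub>C P"
    proof (rule adj_unique)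
      fix x y
      have "cinner (bop_apply B (bop_apply P x)) y = cinner x (bop_apply P (bop_apply (adj B) y))"
        by (metis cinner_adj P(2))
      also have "bop_apply P (bop_apply (adj B) y) = bop_apply (adj B) (bop_apply P y)"
        by (metis comm D'(5) AB(2) times_bop.rep_eq)
      finally show "cinner (bop_apply X x) y = cinner x (bop_apply (adj A + adj B * P + cnj a *\<^sub>C P) y)"
        using cinner_adj[of P x y] cinner_adj[of A x y]
        by (simp add: X bop_apply_simps cinner_add_left cinner_add_right cinner_scaleC_left
            cinner_scaleC_right P(2))
    qed
    then show "adj X \<in> E" using EI D' AB by simp
    fix Y assume "Y \<in> E"
    then obtain A' B' a' where Y: "Y = A' + B' * P + a' *\<^sub>C P" and AB': "A' \<in> \<D>" "B' \<in> \<D>"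
      using EE by blast
    have "X + Y = (A + A') + (B + B') * P + (a + a') *\<^sub>C P"
      by (simp add: X Y scaleC_add_left distrib_right)
    then show "X + Y \<in> E" using EI D' AB AB' by simp
    show "X * Y \<in> E" unfolding X Y prod[OF AB AB'] using D' AB AB' by (intro EI) auto
    show "X * Y = Y * X" unfolding X Y prod[OF AB AB'] prod[OF AB' AB]
      by (simp add: D'(6)[OF AB(1) AB'(1)] D'(6)[OF AB(1) AB'(2)] D'(6)[OF AB(2) AB'(1)]
          D'(6)[OF AB(2) AB'(2)] mult.commute[of a a'] add.assoc add.commute add.left_commute)
  qed
  moreover have "\<D> \<subseteq> E" using EI[OF _ D'(1), of _ 0] by (auto simp: scaleC_zero_left)
  ultimately have "E = \<D>" using D unfolding masa_def by blast
  then show ?thesis using EI[OF D'(1) D'(1), of 1] by (simp add: scaleC_one)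
qed

lemma one_in_masa:
  fixes \<D> :: "'a::complex_hilbert bop set"
  assumes "masa \<D>" shows "1 \<in> \<D>"
proof (rule masa_contains_commuting_projection[OF assms])
  show "adj 1 = (1 :: 'a bop)" by (rule adj_unique) (simp add: one_bop.rep_eq)
qed simp_all

text \<open>Since \<open>\<D>\<close> is selfadjoint, the closure of an invariant subspace is
  reducing; its projection commutes with \<open>\<D>\<close>, and maximality puts it in
  \<open>\<D>\<close>.\<close>

lemma projection_in_masa:
  fixes S :: "'a::complex_hilbert set"
  assumes D: "masa \<D>" and S: "csubspace S" and inv: "\<And>A x. A \<in> \<D> \<Longrightarrow> x \<in> S \<Longrightarrow> bop_apply A x \<in> S"
  obtains P where "P \<in> \<D>" "1 - P \<in> \<D>" "\<And>x. bop_apply P x \<in> closure S"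
    "\<And>x. x \<in> closure S \<Longrightarrow> bop_apply P x = x"
    "\<And>x. norm (bop_apply P x) \<le> norm x" "\<And>x. norm (bop_apply (1 - P) x) \<le> norm x"
proof -
  let ?M = "closure S"
  have cM: "csubspace ?M" using S by (rule csubspace_closure)
  obtain P where P: "\<And>x. bop_apply P x \<in> ?M" "\<And>x. x \<in> ?M \<Longrightarrow> bop_apply P x = x"
    "\<And>x w. w \<in> ?M \<Longrightarrow> inner (x - bop_apply P x) w = 0"
    using projection_exists[OF cM closed_closure] by blast
  have adjD: "adj A \<in> \<D>" and subD: "csubspace \<D>" if "A \<in> \<D>" for A
    using D that unfolding masa_def abelian_selfadjoint_algebra_def by blast+
  have invM: "bop_apply A x \<in> ?M" if "A \<in> \<D>" "x \<in> ?M" for A x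
    by (rule bop_apply_closure[OF _ that(2)]) (use inv[OF that(1)] closure_subset in blast)
  have "P * A = A * P" if "A \<in> \<D>" for A
    using that by (intro projection_commutes[OF cM P]) (auto intro: invM adjD)
  moreover have "P * P = P" by (rule bop_eqI) (simp add: bop_apply_simps P)
  moreover have "adj P = P" using P(1,3) by (rule projection_selfadjoint)
  ultimately have PD: "P \<in> \<D>" using masa_contains_commuting_projection[OF D] by blast
  then have "1 - P \<in> \<D>" using csubspace_diff[OF subD] one_in_masa[OF D] by blast
  from that[OF PD this P(1,2) norm_projection_compl_le[OF P(3)[OF P(1)]]] show ?thesis .
qed

section \<open>The weak* topology\<close>

text \<open>Products of two square-summable sequences are summable because \<open>2 * a * b\<close>
  is at most \<open>a\<^sup>2 + b\<^sup>2\<close>; the sum of the products of norms bounds the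
  functional.\<close>

lemma normal_functional_bounded_linear:
  assumes "f \<in> normal_functionals"
  shows "bounded_linear f"
proof -
  obtain x y where f: "f = (\<lambda>T. \<Sum>n. cinner (bop_apply T (x n)) (y n))"
    and x: "summable (\<lambda>n. (norm (x n))\<^sup>2)" and y: "summable (\<lambda>n. (norm (y n))\<^sup>2)"
    using assms unfolding normal_functionals_def by blast
  define s where "s = (\<lambda>n. norm (x n) * norm (y n))"
  have s: "summable s"
  proof (rule summable_comparison_test)
    show "summable (\<lambda>n. (norm (x n))\<^sup>2 + (norm (y n))\<^sup>2)" using x y by (rule summable_add)
    have "norm (s n) \<le> (norm (x n))\<^sup>2 + (norm (y n))\<^sup>2" for n
    proof -
      have "0 \<le> s n" by (simp add: s_def)
      moreover have "2 * s n \<le> (norm (x n))\<^sup>2 + (norm (y n))\<^sup>2"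
        using sum_squares_bound[of "norm (x n)" "norm (y n)"] by (simp add: s_def mult.assoc)
      ultimately show ?thesis by simp
    qed
    then show "\<exists>N. \<forall>n\<ge>N. norm (s n) \<le> (norm (x n))\<^sup>2 + (norm (y n))\<^sup>2" by blast
  qed
  have trm: "cmod (cinner (bop_apply T (x n)) (y n)) \<le> norm T * s n" for T n
  proof -
    have "cmod (cinner (bop_apply T (x n)) (y n)) \<le> norm (bop_apply T (x n)) * norm (y n)"
      by (rule cmod_cinner_le)
    also have "\<dots> \<le> norm T * norm (x n) * norm (y n)" by (simp add: mult_right_mono norm_bop_apply)
    finally show ?thesis by (simp add: s_def mult.assoc)
  qed
  have sT: "summable (\<lambda>n. norm T * s n)" for T :: "'a bop" using s by (rule summable_mult)
  have sm: "summable (\<lambda>n. cinner (bop_apply T (x n)) (y n))" for T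
    using trm by (intro summable_comparison_test[OF _ sT]) auto
  show ?thesis
  proof (rule bounded_linear_intro[where K = "suminf s"])
    show "f (S + T) = f S + f T" for S T
      unfolding f by (simp add: suminf_add sm bop_apply_simps cinner_add_left)
    show "f (r *\<^sub>R T) = r *\<^sub>R f T" for r T
      unfolding f
      by (simp add: scaleR_scaleC bop_apply_simps cinner_scaleC_left suminf_mult[OF sm] scaleR_conv_of_real
          scaleR_bop.rep_eq)
    show "norm (f T) \<le> norm T * suminf s" for T
      unfolding f suminf_mult[OF s, symmetric] by (rule norm_suminf_le[OF trm sT])
  qed
qed

lemma topspace_weak_star: "topspace weak_star = (UNIV :: 'a::complex_hilbert bop set)"
proof -
  \<comment> \<open>A generated topology lives on the union of its generators; the zero functional
    makes \<open>UNIV\<close> one of them.\<close>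
  have "(\<lambda>T. \<Sum>n. cinner (bop_apply T (0::'a)) 0) \<in> normal_functionals"
    unfolding normal_functionals_def by (intro CollectI exI[of _ "\<lambda>n. 0"]) simp
  then have "UNIV \<in> {f -` V | f V. f \<in> (normal_functionals :: ('a bop \<Rightarrow> complex) set) \<and> open V}"
    by (metis (mono_tags, lifting) mem_Collect_eq open_UNIV vimage_UNIV)
  then show ?thesis
    unfolding weak_star_def topology_generated_by_topspace by blast
qed

lemma normal_functional_continuous:
  assumes "f \<in> normal_functionals"
  shows "continuous_map weak_star euclidean f"
  unfolding continuous_map_def topspace_weak_star
proof (intro conjI allI impI)
  fix V :: "complex set" assume "openin euclidean V"
  then have "openin weak_star (f -` V)"
    unfolding weak_star_def using assms by (intro topology_generated_by_Basis) auto
  then show "openin weak_star {x \<in> UNIV. f x \<in> V}" by (simp add: vimage_def)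
qed simp

text \<open>The universal property of an initial topology: continuity is tested on the functionals
  that generate it.\<close>

lemma continuous_map_into_weak_star:
  fixes g :: "'b \<Rightarrow> 'a::complex_hilbert bop"
  assumes "\<And>f. f \<in> normal_functionals \<Longrightarrow> continuous_map X euclidean (\<lambda>x. f (g x))"
  shows "continuous_map X weak_star g"
  unfolding weak_star_def
proof (rule continuous_on_generated_topo)
  show "g ` topspace X \<subseteq> \<Union> {f -` V |f V. f \<in> normal_functionals \<and> open V}"
    unfolding topspace_weak_star[unfolded weak_star_def topology_generated_by_topspace]
    by (rule subset_UNIV)
  fix U :: "'a bop set" assume "U \<in> {f -` V |f V. f \<in> normal_functionals \<and> open V}"
  then obtain f V where f: "f \<in> normal_functionals" and V: "open V" and U: "U = f -` V" by blast
  have "{x \<in> topspace X. f (g x) \<in> V} = g -` U \<inter> topspace X" unfolding U by auto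
  then show "openin X (g -` U \<inter> topspace X)"
    using openin_continuous_map_preimage[OF assms[OF f], of V] V by simp
qed

text \<open>Normal functionals are norm continuous, so the norm topology is finer than the weak*
  topology.\<close>

lemma closed_if_closedin_weak_star:
  assumes "closedin weak_star X" shows "closed X"
proof -
  have "continuous_map euclidean weak_star (\<lambda>x. x)"
    by (rule continuous_map_into_weak_star)
      (simp add: normal_functional_bounded_linear linear_continuous_on)
  from closedin_continuous_map_preimage[OF this assms] show ?thesis by simp
qed

text \<open>Linearity of each normal functional reduces the claim to a difference of two continuous
  complex-valued functions.\<close>

lemma continuous_map_weak_star_id_minus:
  assumes "continuous_map weak_star weak_star \<Phi>"
  shows "continuous_map weak_star weak_star (\<lambda>T. T - \<Phi> T)"
proof (rule continuous_map_into_weak_star)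
  fix f :: "'a bop \<Rightarrow> complex" assume f: "f \<in> normal_functionals"
  then interpret f: bounded_linear f by (rule normal_functional_bounded_linear)
  have "continuous_map weak_star euclidean (\<lambda>T. f T - f (\<Phi> T))"
    using normal_functional_continuous[OF f]
      continuous_map_compose[OF assms normal_functional_continuous[OF f]]
    by (intro continuous_map_diff) (auto simp: o_def)
  then show "continuous_map weak_star euclidean (\<lambda>T. f (T - \<Phi> T))" by (simp add: f.diff)
qed

section \<open>Pointwise distances\<close>

lemma INF_norm_le:
  fixes T :: "'a::complex_hilbert bop"
  assumes "X \<in> \<X>"
  shows "(INF X\<in>\<X>. norm (bop_apply T \<xi> - bop_apply X \<xi>)) \<le> norm (bop_apply T \<xi> - bop_apply X \<xi>)"
  using assms by (intro cINF_lower) (auto intro!: bdd_belowI2[where m = 0])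

text \<open>Choosing \<open>0\<close> in \<open>\<X>\<close> bounds every infimum by
  \<open>norm T\<close>, so the supremum is taken over a bounded set.\<close>

lemma INF_le_alpha:
  assumes "0 \<in> \<X>" and "norm \<xi> = 1"
  shows "(INF X\<in>\<X>. norm (bop_apply T \<xi> - bop_apply X \<xi>)) \<le> alpha T \<X>"
  unfolding alpha_def
proof (rule cSup_upper)
  show "bdd_above (insert 0 {INF X\<in>\<X>. norm (bop_apply T \<xi> - bop_apply X \<xi>) |\<xi>. norm \<xi> = 1})"
  proof (rule bdd_aboveI[where M = "norm T"])
    fix r assume "r \<in> insert 0 {INF X\<in>\<X>. norm (bop_apply T \<xi> - bop_apply X \<xi>) |\<xi>. norm \<xi> = 1}"
    then consider "r = 0" | \<xi> where "norm \<xi> = 1"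
      "r = (INF X\<in>\<X>. norm (bop_apply T \<xi> - bop_apply X \<xi>))" by blast
    then show "r \<le> norm T"
    proof cases
      case 2
      then show ?thesis
        using INF_norm_le[OF assms(1), of T \<xi>] norm_bop_apply[of T \<xi>] by (simp add: bop_apply_simps)
    qed simp
  qed
qed (use assms in blast)

lemma alpha_nonneg: "0 \<in> \<X> \<Longrightarrow> 0 \<le> alpha T \<X>"
proof (cases "\<exists>\<xi>::'a. norm \<xi> = 1")
  case True
  assume "0 \<in> \<X>"
  from True obtain \<xi> :: 'a where \<xi>: "norm \<xi> = 1" by blast
  have "0 \<le> (INF X\<in>\<X>. norm (bop_apply T \<xi> - bop_apply X \<xi>))"
    using \<open>0 \<in> \<X>\<close> by (intro cINF_greatest) auto
  then show ?thesis using INF_le_alpha[OF \<open>0 \<in> \<X>\<close> \<xi>] by (rule order_trans)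
next
  \<comment> \<open>In the zero space there are no unit vectors, and \<open>alpha\<close> is the
    supremum of the inserted \<open>0\<close> alone.\<close>
  case False
  then show ?thesis unfolding alpha_def by simp
qed

lemma alpha_le:
  assumes "0 \<le> r" and "\<And>\<xi>. norm \<xi> = 1 \<Longrightarrow> (INF X\<in>\<X>. norm (bop_apply T \<xi> - bop_apply X \<xi>)) \<le> r"
  shows "alpha T \<X> \<le> r"
  unfolding alpha_def using assms by (intro cSup_least) auto

text \<open>Homogeneity extends the bound beyond unit vectors, as required for vectors shortened by
  a contraction.\<close>

lemma INF_le_alpha_mult_norm:
  fixes T :: "'a::complex_hilbert bop"
  assumes "0 \<in> \<X>"
  shows "(INF X\<in>\<X>. norm (bop_apply T \<eta> - bop_apply X \<eta>)) \<le> alpha T \<X> * norm \<eta>"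
proof (cases "\<eta> = 0")
  case True
  then show ?thesis using INF_norm_le[OF assms, of T 0]
    by (simp add: bop_apply_simps bounded_linear.linear[OF bounded_linear_bop_apply] linear_0)
next
  case False
  define u where "u = sgn \<eta>"
  have u: "norm u = 1" "\<eta> = norm \<eta> *\<^sub>R u" using False by (simp_all add: u_def norm_sgn sgn_div_norm)
  have "(INF X\<in>\<X>. norm (bop_apply T \<eta> - bop_apply X \<eta>)) / norm \<eta>
      \<le> (INF X\<in>\<X>. norm (bop_apply T u - bop_apply X u))"
  proof (rule cINF_greatest)
    fix X assume "X \<in> \<X>"
    have "bop_apply S \<eta> = norm \<eta> *\<^sub>R bop_apply S u" for S
      by (metis u(2) bounded_linear_bop_apply linear_simps(5))
    then have "norm (bop_apply T \<eta> - bop_apply X \<eta>) = norm \<eta> * norm (bop_apply T u - bop_apply X u)"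
      by (metis abs_norm_cancel norm_scaleR scaleR_diff_right)
    with INF_norm_le[OF \<open>X \<in> \<X>\<close>, of T \<eta>] False
    show "(INF X\<in>\<X>. norm (bop_apply T \<eta> - bop_apply X \<eta>)) / norm \<eta>
        \<le> norm (bop_apply T u - bop_apply X u)" by (simp add: field_simps)
  qed (use assms in auto)
  also have "\<dots> \<le> alpha T \<X>" by (rule INF_le_alpha[OF assms u(1)])
  finally show ?thesis using False by (simp add: field_simps)
qed

text \<open>An approximant \<open>X\<close> of \<open>T\<close> at \<open>bop_apply Q \<eta>\<close>
  gives the approximant \<open>R * X * Q\<close> at \<open>\<eta>\<close>; \<open>R\<close> does not
  increase the error, and \<open>Q\<close> does not increase the norm of the test vector.\<close>

lemma alpha_compression_le:
  fixes T :: "'a::complex_hilbert bop"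
  assumes 0: "0 \<in> \<X>" "0 \<in> \<Y>"
    and le: "\<And>x. norm (bop_apply R x) \<le> norm x" "\<And>x. norm (bop_apply Q x) \<le> norm x"
    and comp: "\<And>X. X \<in> \<X> \<Longrightarrow> R * X * Q \<in> \<Y>"
  shows "alpha (R * T * Q) \<Y> \<le> alpha T \<X>"
proof (rule alpha_le)
  show nn: "0 \<le> alpha T \<X>" using 0(1) by (rule alpha_nonneg)
  fix \<eta> :: 'a assume "norm \<eta> = 1"
  have "(INF Y\<in>\<Y>. norm (bop_apply (R * T * Q) \<eta> - bop_apply Y \<eta>))
      \<le> (INF X\<in>\<X>. norm (bop_apply T (bop_apply Q \<eta>) - bop_apply X (bop_apply Q \<eta>)))"
  proof (rule cINF_greatest)
    fix X assume "X \<in> \<X>"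
    let ?v = "bop_apply T (bop_apply Q \<eta>) - bop_apply X (bop_apply Q \<eta>)"
    have "(INF Y\<in>\<Y>. norm (bop_apply (R * T * Q) \<eta> - bop_apply Y \<eta>))
        \<le> norm (bop_apply (R * T * Q) \<eta> - bop_apply (R * X * Q) \<eta>)"
      by (rule INF_norm_le[OF comp[OF \<open>X \<in> \<X>\<close>]])
    also have "bop_apply (R * T * Q) \<eta> - bop_apply (R * X * Q) \<eta> = bop_apply R ?v"
      by (simp add: bop_apply_simps linear_diff[OF bounded_linear.linear[OF bounded_linear_bop_apply]])
    also have "norm (bop_apply R ?v) \<le> norm ?v" by (rule le)
    finally show "(INF Y\<in>\<Y>. norm (bop_apply (R * T * Q) \<eta> - bop_apply Y \<eta>)) \<le> norm ?v" .
  qed (use 0 in auto)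
  also have "\<dots> \<le> alpha T \<X> * norm (bop_apply Q \<eta>)" by (rule INF_le_alpha_mult_norm[OF 0(1)])
  also have "\<dots> \<le> alpha T \<X>" using le(2)[of \<eta>] \<open>norm \<eta> = 1\<close> nn by (simp add: mult_left_le)
  finally show "(INF Y\<in>\<Y>. norm (bop_apply (R * T * Q) \<eta> - bop_apply Y \<eta>)) \<le> alpha T \<X>" .
qed

section \<open>Sums with ranges of Schur idempotents\<close>

lemma schur_idempotent_simps:
  assumes "schur_idempotent \<D> \<Phi>"
  shows "\<Phi> (S + T) = \<Phi> S + \<Phi> T" "\<Phi> (c *\<^sub>C T) = c *\<^sub>C \<Phi> T" "\<Phi> (S - T) = \<Phi> S - \<Phi> T" "\<Phi> 0 = 0"
    "\<Phi> (\<Phi> T) = \<Phi> T"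
    "A \<in> \<D> \<Longrightarrow> B \<in> \<D> \<Longrightarrow> \<Phi> (A * T * B) = A * \<Phi> T * B"
proof -
  have lin: "clinear \<Phi>" using assms unfolding schur_idempotent_def by blast
  show add: "\<Phi> (S + T) = \<Phi> S + \<Phi> T" for S T
    by (metis lin Vector_Spaces.linear.axioms(3) module_hom.add)
  show "\<Phi> (c *\<^sub>C T) = c *\<^sub>C \<Phi> T"
    by (metis lin Vector_Spaces.linear.axioms(3) module_hom.scale)
  show "\<Phi> (S - T) = \<Phi> S - \<Phi> T" by (metis add add_diff_cancel diff_add_cancel)
  show "\<Phi> 0 = 0" by (metis add add_cancel_right_right)
  show "\<Phi> (\<Phi> T) = \<Phi> T"
    using assms unfolding schur_idempotent_def by (metis comp_apply)
  show "A \<in> \<D> \<Longrightarrow> B \<in> \<D> \<Longrightarrow> \<Phi> (A * T * B) = A * \<Phi> T * B"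
    using assms unfolding schur_idempotent_def by blast
qed

lemma csubspace_vector_image:
  fixes \<X> :: "'a::complex_hilbert bop set"
  assumes "csubspace \<X>"
  shows "csubspace ((\<lambda>X. bop_apply X \<xi>) ` \<X>)"
  using assms unfolding csubspace_iff
  by (auto simp: image_iff) (metis zero_bop.rep_eq, metis plus_bop.rep_eq, metis scaleC_bop.rep_eq)

text \<open>With \<open>P\<close> and \<open>Q\<close> the projections onto the closures of \<open>\<U>\<xi>\<close> and \<open>\<D>\<xi>\<close>, both in \<open>\<D>\<close>, the distance
  of \<open>(T - \<Phi> T) \<xi>\<close> to \<open>\<U>\<xi>\<close> is the norm of \<open>(S - \<Phi> S) \<xi>\<close> for \<open>S = (1 - P) * T * Q\<close>, while
  \<open>(1 - P) * X * Q = 0\<close> for \<open>X \<in> \<U>\<close>.\<close>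

lemma alpha_compl_le:
  fixes \<D> \<U> :: "'a::complex_hilbert bop set"
  assumes D: "masa \<D>" and U: "masa_bimodule \<D> \<U>" and S: "schur_idempotent \<D> \<Phi>"
    and l: "l > 0" "\<And>T. norm (T - \<Phi> T) \<le> l * alpha T (range \<Phi>)"
  shows "alpha (T - \<Phi> T) \<U> \<le> l * alpha T {X + Y | X Y. X \<in> \<U> \<and> Y \<in> range \<Phi>}"
    (is "_ \<le> l * alpha T ?W")
proof (rule alpha_le)
  note \<Phi> = schur_idempotent_simps[OF S]
  have cU: "csubspace \<U>" and UD: "\<And>A X B. A \<in> \<D> \<Longrightarrow> X \<in> \<U> \<Longrightarrow> B \<in> \<D> \<Longrightarrow> A * X * B \<in> \<U>"
    using U unfolding masa_bimodule_def by blast+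
  have cD: "csubspace \<D>" and DD: "\<And>A B. A \<in> \<D> \<Longrightarrow> B \<in> \<D> \<Longrightarrow> A * B \<in> \<D>"
    using D unfolding masa_def abelian_selfadjoint_algebra_def by blast+
  have 1: "1 \<in> \<D>" using D by (rule one_in_masa)
  have zR: "0 \<in> range \<Phi>" using \<Phi>(4) by (metis rangeI)
  then have 0: "0 \<in> range \<Phi>" "0 \<in> ?W" using cU unfolding csubspace_iff by force+
  show "0 \<le> l * alpha T ?W" using l(1) alpha_nonneg[OF 0(2)] by simp
  fix \<xi> :: 'a assume \<xi>: "norm \<xi> = 1"
  let ?U = "(\<lambda>X. bop_apply X \<xi>) ` \<U>" and ?D = "(\<lambda>X. bop_apply X \<xi>) ` \<D>"
  have invU: "bop_apply A x \<in> ?U" if "A \<in> \<D>" "x \<in> ?U" for A x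
    using UD[OF that(1) _ 1] that(2) by (auto simp: image_iff times_bop.rep_eq) (metis times_bop.rep_eq)
  have invD: "bop_apply A x \<in> ?D" if "A \<in> \<D>" "x \<in> ?D" for A x
    using DD that by (auto simp: image_iff) (metis times_bop.rep_eq)
  obtain P where P: "P \<in> \<D>" "1 - P \<in> \<D>" "\<And>x. bop_apply P x \<in> closure ?U"
    "\<And>x. x \<in> closure ?U \<Longrightarrow> bop_apply P x = x" "\<And>x. norm (bop_apply (1 - P) x) \<le> norm x"
    using projection_in_masa[OF D csubspace_vector_image[OF cU] invU] by metis
  obtain Q where Q: "Q \<in> \<D>" "\<And>x. bop_apply Q x \<in> closure ?D"
    "\<And>x. x \<in> closure ?D \<Longrightarrow> bop_apply Q x = x" "\<And>x. norm (bop_apply Q x) \<le> norm x"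
    using projection_in_masa[OF D csubspace_vector_image[OF cD] invD] by metis
  have "\<xi> \<in> ?D" using 1 by (force simp: one_bop.rep_eq)
  then have Q\<xi>: "bop_apply Q \<xi> = \<xi>" by (intro Q(3) subsetD[OF closure_subset])
  have kill: "(1 - P) * X * Q = 0" if "X \<in> \<U>" for X
  \<comment> \<open>Each \<open>X * A\<close> with \<open>A\<close> in \<open>\<D>\<close> is in
    \<open>\<U>\<close>. By continuity \<open>X\<close> maps the closure of \<open>?D\<close> into
    the closure of \<open>?U\<close>, which \<open>1 - P\<close> annihilates.\<close>
  proof (rule bop_eqI)
    fix x
    have "bop_apply X (bop_apply Q x) \<in> closure ?U"
    proof (rule bop_apply_closure[OF _ Q(2)])
      fix y assume "y \<in> ?D"
      then obtain A where A: "A \<in> \<D>" "y = bop_apply A \<xi>" by blast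
      have "bop_apply X y = bop_apply (1 * X * A) \<xi>" by (simp add: A times_bop.rep_eq)
      with UD[OF 1 that A(1)] have "bop_apply X y \<in> ?U" by (rule rev_image_eqI)
      then show "bop_apply X y \<in> closure ?U" by (rule subsetD[OF closure_subset])
    qed
    then show "bop_apply ((1 - P) * X * Q) x = bop_apply 0 x" by (simp add: bop_apply_simps P)
  qed
  let ?S = "(1 - P) * T * Q"
  let ?v = "bop_apply (T - \<Phi> T) \<xi>"
  have "(INF X\<in>\<U>. norm (?v - bop_apply X \<xi>)) \<le> norm (bop_apply (1 - P) ?v)"
  \<comment> \<open>\<open>bop_apply P ?v\<close> lies only in the closure of \<open>?U\<close>, so
    it is approximated by vectors \<open>bop_apply X \<xi>\<close> up to \<open>e\<close>.\<close>
  proof (rule field_le_epsilon)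
    fix e :: real assume "0 < e"
    then obtain X where X: "X \<in> \<U>" "dist (bop_apply X \<xi>) (bop_apply P ?v) < e"
      using P(3)[of ?v] unfolding closure_approachable by blast
    have "norm (?v - bop_apply X \<xi>) \<le> norm (?v - bop_apply P ?v) + dist (bop_apply X \<xi>) (bop_apply P ?v)"
      using dist_triangle[of ?v "bop_apply X \<xi>" "bop_apply P ?v"]
      by (simp add: dist_commute flip: dist_norm)
    with INF_norm_le[OF X(1), of "T - \<Phi> T" \<xi>] X(2)
    show "(INF X\<in>\<U>. norm (?v - bop_apply X \<xi>)) \<le> norm (bop_apply (1 - P) ?v) + e"
      by (simp add: bop_apply_simps)
  qed
  \<comment> \<open>The bimodule property moves \<open>1 - P\<close> and \<open>Q\<close> through
    \<open>\<Phi>\<close>, and \<open>Q\<close> can be inserted because it fixes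
    \<open>\<xi>\<close>.\<close>
  also have "bop_apply (1 - P) ?v = bop_apply (?S - \<Phi> ?S) \<xi>"
    using \<Phi>(6)[OF P(2) Q(1), of T]
    by (simp add: bop_apply_simps Q\<xi> linear_diff[OF bounded_linear.linear[OF bounded_linear_bop_apply]])
  also have "norm \<dots> \<le> norm (?S - \<Phi> ?S)"
    using norm_bop_apply[of "?S - \<Phi> ?S" \<xi>] \<xi> by simp
  also have "\<dots> \<le> l * alpha ?S (range \<Phi>)" by (rule l)
  also have "\<dots> \<le> l * alpha T ?W"
  proof (intro mult_left_mono alpha_compression_le 0 P Q)
    fix Z assume "Z \<in> ?W"
    then obtain X Y where "X \<in> \<U>" "Z = X + \<Phi> Y" by blast
    \<comment> \<open>The compression annihilates the summand from \<open>\<U>\<close> and passes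
      inside \<open>\<Phi>\<close> on the other one.\<close>
    then have "(1 - P) * Z * Q = \<Phi> ((1 - P) * Y * Q)"
      using kill \<Phi>(6)[OF P(2) Q(1)] by (simp add: distrib_left distrib_right)
    then show "(1 - P) * Z * Q \<in> range \<Phi>" by simp
  qed (use l in simp)
  finally show "(INF X\<in>\<U>. norm (?v - bop_apply X \<xi>)) \<le> l * alpha T ?W" .
qed

theorem lemma4p1:
  fixes \<D> \<U> :: "'a::complex_hilbert bop set" and \<Phi> :: "'a bop \<Rightarrow> 'a bop"
  assumes "separable_space (euclidean :: 'a topology)"
    and "masa \<D>"
    and "masa_bimodule \<D> \<U>"
    and "hyperreflexive \<U>"
    and "\<Phi> \<in> schur_frakH \<D>"
  shows "hyperreflexive {X + Y | X Y. X \<in> \<U> \<and> Y \<in> range \<Phi>} \<and>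
    hyperreflexivity_constant {X + Y | X Y. X \<in> \<U> \<and> Y \<in> range \<Phi>}
      \<le> hyperreflexivity_constant \<U> * schur_constant \<Phi>"
proof -
  let ?W = "{X + Y | X Y. X \<in> \<U> \<and> Y \<in> range \<Phi>}"
  \<comment> \<open>Estimates are proved for every pair of admissible constants from
    \<open>K\<close> and \<open>L\<close>; infima are taken only at the end.\<close>
  define K where "K = {k. k > 0 \<and> (\<forall>T. infdist T \<U> \<le> k * alpha T \<U>)}"
  define L where "L = {l. l > 0 \<and> (\<forall>T. norm (T - \<Phi> T) \<le> l * alpha T (range \<Phi>))}"
  have cU: "csubspace \<U>" and wU: "closedin weak_star \<U>" and "K \<noteq> {}"
    using assms(4) unfolding hyperreflexive_def K_def by blast+
  have S: "schur_idempotent \<D> \<Phi>" and "L \<noteq> {}"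
    using assms(5) unfolding schur_frakH_def L_def by blast+
  note \<Phi> = schur_idempotent_simps[OF S]
  have zU: "0 \<in> \<U>" using cU by (simp add: csubspace_iff)
  have zR: "0 \<in> range \<Phi>" using \<Phi>(4) by (metis rangeI)
  have UW: "\<U> \<subseteq> ?W" using zR by force
  have 0: "0 \<in> \<U>" "0 \<in> ?W" using zU UW by blast+
  have compl: "alpha (T - \<Phi> T) \<U> \<le> l * alpha T ?W" if "l \<in> L" for l T
    using that by (intro alpha_compl_le[OF assms(2,3) S]) (auto simp: L_def)
  obtain k l where kl: "k \<in> K" "l \<in> L" using \<open>K \<noteq> {}\<close> \<open>L \<noteq> {}\<close> by blast
  have \<Phi>U: "X - \<Phi> X \<in> \<U>" if "X \<in> \<U>" for X
  proof -
    have "alpha X ?W \<le> 0"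
    proof (rule alpha_le)
      fix \<xi> :: 'a
      have "X \<in> ?W" using that UW by blast
      from INF_norm_le[OF this, of X \<xi>]
      show "(INF Z\<in>?W. norm (bop_apply X \<xi> - bop_apply Z \<xi>)) \<le> 0" by simp
    qed simp
    then have "alpha (X - \<Phi> X) \<U> \<le> 0"
      using compl[OF kl(2), of X] kl(2) unfolding L_def
      by (smt (verit) mem_Collect_eq mult_nonneg_nonpos)
    then have "infdist (X - \<Phi> X) \<U> \<le> 0"
      using kl(1) unfolding K_def by (smt (verit) mem_Collect_eq mult_nonneg_nonpos)
    then have "infdist (X - \<Phi> X) \<U> = 0" by (simp add: infdist_nonneg order_antisym)
    \<comment> \<open>Zero distance means membership because the weak* closed \<open>\<U>\<close> is
      norm closed.\<close>
    then show ?thesis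
      using in_closed_iff_infdist_zero[OF closed_if_closedin_weak_star[OF wU]] 0 by blast
  qed
  have W: "?W = {T \<in> topspace weak_star. T - \<Phi> T \<in> \<U>}"
  proof (intro set_eqI iffI)
    fix Z assume "Z \<in> ?W"
    then obtain X Y where "X \<in> \<U>" "Z = X + \<Phi> Y" by blast
    \<comment> \<open>Idempotence cancels the terms in \<open>Y\<close>, leaving
      \<open>X - \<Phi> X\<close>.\<close>
    then show "Z \<in> {T \<in> topspace weak_star. T - \<Phi> T \<in> \<U>}"
      using \<Phi>U by (simp add: topspace_weak_star \<Phi>)
  next
    fix Z assume "Z \<in> {T \<in> topspace weak_star. T - \<Phi> T \<in> \<U>}"
    then have "Z - \<Phi> Z \<in> \<U>" by simp
    moreover have "Z = (Z - \<Phi> Z) + \<Phi> Z" by simp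
    ultimately show "Z \<in> ?W" by blast
  qed
  have wW: "closedin weak_star ?W"
    unfolding W
    by (rule closedin_continuous_map_preimage[OF continuous_map_weak_star_id_minus wU])
      (use S in \<open>simp add: schur_idempotent_def\<close>)
  have cW: "csubspace ?W"
    unfolding W csubspace_iff topspace_weak_star
    using cU
    by (auto simp: \<Phi> csubspace_iff add_diff_add simp flip: scaleC_minus_right)
  have bound: "k * l \<in> {k. k > 0 \<and> (\<forall>T. infdist T ?W \<le> k * alpha T ?W)}"
    if k: "k \<in> K" and l: "l \<in> L" for k l
  proof (intro CollectI conjI allI)
    show "0 < k * l" using k l by (simp add: K_def L_def)
    fix T
    have "infdist T ?W \<le> infdist (T - \<Phi> T) \<U>"
    proof -
      have "infdist T ?W \<le> dist (T - \<Phi> T) X" if "X \<in> \<U>" for X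
      proof -
        \<comment> \<open>This element is as far from \<open>T\<close> as \<open>X\<close> is from
          \<open>T - \<Phi> T\<close>.\<close>
        have "X + \<Phi> T \<in> ?W" using that by blast
        then have "infdist T ?W \<le> dist T (X + \<Phi> T)" by (rule infdist_le)
        also have "\<dots> = dist (T - \<Phi> T) X" by (simp add: dist_norm algebra_simps)
        finally show ?thesis .
      qed
      then show ?thesis using 0(1) by (auto simp: infdist_def[of _ \<U>] intro!: cINF_greatest)
    qed
    also have "\<dots> \<le> k * alpha (T - \<Phi> T) \<U>" using k by (simp add: K_def)
    also have "\<dots> \<le> k * (l * alpha T ?W)"
      by (rule mult_left_mono[OF compl[OF l]]) (use k in \<open>simp add: K_def\<close>)
    finally show "infdist T ?W \<le> k * l * alpha T ?W" by (simp add: mult.assoc)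
  qed
  have hW: "hyperreflexivity_constant ?W \<le> k * l" if "k \<in> K" "l \<in> L" for k l
    unfolding hyperreflexivity_constant_def
    by (rule cInf_lower[OF bound[OF that]]) (rule bdd_belowI[where m = 0], simp)
  have "hyperreflexivity_constant ?W \<le> Inf K * Inf L"
  proof -
    have *: "hyperreflexivity_constant ?W \<le> Inf K * l" if l: "l \<in> L" for l
    proof -
      have "0 < l" using l by (simp add: L_def)
      have "hyperreflexivity_constant ?W / l \<le> Inf K"
        using hW[OF _ l] \<open>0 < l\<close> \<open>K \<noteq> {}\<close> by (intro cInf_greatest) (simp_all add: pos_divide_le_eq)
      then show ?thesis using \<open>0 < l\<close> by (simp add: pos_divide_le_eq)
    qed
    have "0 \<le> Inf K" using \<open>K \<noteq> {}\<close> by (intro cInf_greatest) (auto simp: K_def)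
    \<comment> \<open>Admissible constants are positive, but their infimum can vanish, for instance
      when \<open>\<U>\<close> contains all operators. Division by \<open>Inf K\<close> is then
      excluded, and the bound for a single \<open>l\<close> already suffices.\<close>
    then consider "Inf K = 0" | "0 < Inf K" by linarith
    then show ?thesis
    proof cases
      case 1
      then show ?thesis using *[OF kl(2)] by simp
    next
      case 2
      have "hyperreflexivity_constant ?W / Inf K \<le> Inf L"
        using * 2 \<open>L \<noteq> {}\<close>
        by (intro cInf_greatest) (simp_all add: pos_divide_le_eq mult.commute)
      then show ?thesis using 2 by (simp add: pos_divide_le_eq mult.commute)
    qed
  qed
  moreover have "hyperreflexive ?W"
    unfolding hyperreflexive_def using cW wW bound[OF kl] by blast
  moreover have "Inf K = hyperreflexivity_constant \<U>" "Inf L = schur_constant \<Phi>"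
    by (simp_all only: hyperreflexivity_constant_def schur_constant_def K_def L_def)
  ultimately show ?thesis by (simp only: simp_thms)
qed

end
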